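(* Let $X,Y$ be Banach spaces, $D\subset X$ a convex open subset, and $T:D\subset X\to Y$ a continuously Fréchet differentiable operator. Let $\psi_0>0$ and $\psi>0$ be parameters with $\psi_0\le\psi$, and let $\rho>0$ be the radius determined by $\psi_0,\psi$ as defined in the context. Assume that there exists $x^*\in D$ such that $T(x^* )=0$, $[T'(x^* )]^{-1}\in L(Y,X)$, and for all $x,y\in D$ $$\|[T'(x^* )]^{-1}(T'(x)-T'(x^* ))\|\le \psi_0\|x-x^*\|,$$ $$\|[T'(x^* )]^{-1}(T'(x)-T'(y))\|\le \psi\|x-y\|,$$ and that $B(x^*,\rho)\subseteq D$. Let $x_0\in B(x^*,\rho)\setminus\{x^*\}$. Then the sequence $\{x_n\}$ generated from $x_0$ by $$y_n=x_n-\tfrac12[T'(x_n)]^{-1}T(x_n),\qquad z_n^{(1)}=x_n-[T'(y_n)]^{-1}T(x_n),$$ $$z_n^{(2)}=z_n^{(1)}-\big(2[T'(y_n)]^{-1}-[T'(x_n)]^{-1}\big)T(z_n^{(1)}),$$ $$x_{n+1}=z_n^{(2)}-\big(2[T'(y_n)]^{-1}-[T'(x_n)]^{-1}\big)T(z_n^{(2)})$$ is well defined, remains in $B(x^*,\rho)$ for each $n=0,1,2,\dots$, and converges to $x^*$. Moreover, for all $n=0,1,2,\dots$: $$\|y_n-x^*\|\le \eta_1(\|x_n-x^*\|)\|x_n-x^*\|\le\|x_n-x^*\|<\rho,$$ $$\|z_n^{(1)}-x^*\|\le \eta_2(\|x_n-x^*\|)\|x_n-x^*\|\le\|x_n-x^*\|<\rho,$$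 $$\|z_n^{(2)}-x^*\|\le \eta_3(\|x_n-x^*\|)\|x_n-x^*\|\le\|x_n-x^*\|<\rho,$$ $$\|x_{n+1}-x^*\|\le \eta_4(\|x_n-x^*\|)\|x_n-x^*\|\le\|x_n-x^*\|<\rho,$$ where $\eta_1,\dots,\eta_4$ are the functions defined in the context. Furthermore, if there exists $\varrho\in[\rho,\frac1{\psi_0})$ such that $\overline{B(x^*,\varrho)}\subseteq D$, then $x^*$ is the only solution of the equation $T(x)=0$ in $D_1=D\cap\overline{B(x^*,\varrho)}$.
   Context: $L(Y,X)$ denotes the set of bounded linear operators from $Y$ to $X$; $T'(x)$ is the first Fréchet derivative of $T$ at $x$; $B(x^*,r)$ and $\overline{B(x^*,r)}$ are the open and closed balls in $X$ with center $x^*$ and radius $r$. For $\psi_0,\psi>0$ with $\psi_0\le\psi$, define the following functions of $a\in[0,\frac1{\psi_0})$ (wherever the denominators are nonzero): $$\eta_1(a)=\frac{1}{1-\psi_0a}\left[\frac{\psi a}{2}+\frac{1+\frac{\psi_0}{2}a}{2}\right],\qquad p(a)=\psi_0\eta_1(a)a,$$ $$\eta_2(a)=\frac{1}{1-\psi_0a}\left[\frac{\psi a}{2}+\frac{\psi[1+\eta_1(a)]\left[\frac{\psi_0}{2}a+1\right]a}{1-p(a)}\right],$$ and, for $j=3,4$, $$\eta_j(a)=\Bigg[\frac{\psi\eta_{j-1}(a)a}{2(1-\psi_0\eta_{j-1}(a)a)}+\frac{\psi[\eta_1(a)+\eta_{j-1}(a)]}{1-\psi_0\eta_{j-1}(a)a}\cdot\frac{1}{1-p(a)}\left(1+\frac{\psi_0}{2}\eta_{j-1}(a)a\right)a$$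 $$\qquad+\frac{1}{1-\psi_0a}\cdot\frac{\psi[a+\eta_1(a)a]}{1-p(a)}\left(1+\frac{\psi_0}{2}\eta_{j-1}(a)a\right)\Bigg]\eta_{j-1}(a).$$ Put $H_i(a)=\eta_i(a)-1$ for $i=1,2,3,4$, and let $\rho_i$ be the smallest zero of $H_i$ in $(0,\frac1{\psi_0})$ (these zeros exist; in particular $\rho_1=\frac{2}{2\psi+5\psi_0}$). The radius is $\rho=\min\{\rho_1,\rho_2,\rho_3,\rho_4\}$. *)

theory Defs
  imports "HOL-Analysis.Analysis"
begin

section \<open>Inverses in the space of bounded linear operators\<close>

definition blinfun_inverse_of ::
  "('a::real_normed_vector \<Rightarrow>\<^sub>L 'b::real_normed_vector) \<Rightarrow> ('b \<Rightarrow>\<^sub>L 'a) \<Rightarrow> bool"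
  where "blinfun_inverse_of A B \<longleftrightarrow> B o\<^sub>L A = id_blinfun \<and> A o\<^sub>L B = id_blinfun"

definition blinfun_invertible ::
  "('a::real_normed_vector \<Rightarrow>\<^sub>L 'b::real_normed_vector) \<Rightarrow> bool"
  where "blinfun_invertible A \<longleftrightarrow> (\<exists>B. blinfun_inverse_of A B)"

text \<open>Two-sided inverses are unique, so this is the inverse whenever
  \<^term>\<open>blinfun_invertible A\<close> holds, and an unspecified operator otherwise.\<close>

definition blinfun_inv ::
  "('a::real_normed_vector \<Rightarrow>\<^sub>L 'b::real_normed_vector) \<Rightarrow> ('b \<Rightarrow>\<^sub>L 'a)"
  where "blinfun_inv A = (THE B. blinfun_inverse_of A B)"

lemma blinfun_inverse_of_unique:
  assumes "blinfun_inverse_of A B" "blinfun_inverse_of A C"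
  shows "B = C"
proof (rule blinfun_eqI)
  fix v
  have "blinfun_apply A (blinfun_apply C v) = v"
    using assms(2) unfolding blinfun_inverse_of_def
    by (metis blinfun_apply_blinfun_compose id_blinfun.rep_eq id_apply)
  moreover have "blinfun_apply B (blinfun_apply A (blinfun_apply C v)) = blinfun_apply C v"
    using assms(1) unfolding blinfun_inverse_of_def
    by (metis blinfun_apply_blinfun_compose id_blinfun.rep_eq id_apply)
  ultimately show "blinfun_apply B v = blinfun_apply C v"
    by simp
qed

lemma blinfun_inv_eqI: "blinfun_inverse_of A B \<Longrightarrow> blinfun_inv A = B"
  unfolding blinfun_inv_def by (rule the_equality) (auto intro: blinfun_inverse_of_unique)

section \<open>The majorant functions and the radius\<close>

definition eta1 :: "real \<Rightarrow> real \<Rightarrow> real \<Rightarrow> real"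
  where "eta1 \<psi>0 \<psi> a =
    1 / (1 - \<psi>0 * a) * (\<psi> * a / 2 + (1 + \<psi>0 / 2 * a) / 2)"

definition p_fun :: "real \<Rightarrow> real \<Rightarrow> real \<Rightarrow> real"
  where "p_fun \<psi>0 \<psi> a = \<psi>0 * eta1 \<psi>0 \<psi> a * a"

definition eta2 :: "real \<Rightarrow> real \<Rightarrow> real \<Rightarrow> real"
  where "eta2 \<psi>0 \<psi> a =
    1 / (1 - \<psi>0 * a) *
      (\<psi> * a / 2 + \<psi> * (1 + eta1 \<psi>0 \<psi> a) * (\<psi>0 / 2 * a + 1) * a / (1 - p_fun \<psi>0 \<psi> a))"

text \<open>The step from \<open>\<eta> = \<eta>\<^sub>j\<^sub>-\<^sub>1\<close> to \<open>\<eta>\<^sub>j\<close>, for \<open>j = 3, 4\<close>.\<close>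

definition eta_next :: "real \<Rightarrow> real \<Rightarrow> (real \<Rightarrow> real) \<Rightarrow> real \<Rightarrow> real"
  where "eta_next \<psi>0 \<psi> \<eta> a =
    (\<psi> * \<eta> a * a / (2 * (1 - \<psi>0 * \<eta> a * a))
     + \<psi> * (eta1 \<psi>0 \<psi> a + \<eta> a) / (1 - \<psi>0 * \<eta> a * a)
         * (1 / (1 - p_fun \<psi>0 \<psi> a)) * (1 + \<psi>0 / 2 * \<eta> a * a) * a
     + 1 / (1 - \<psi>0 * a)
         * (\<psi> * (a + eta1 \<psi>0 \<psi> a * a) / (1 - p_fun \<psi>0 \<psi> a)) * (1 + \<psi>0 / 2 * \<eta> a * a))
    * \<eta> a"

definition eta3 :: "real \<Rightarrow> real \<Rightarrow> real \<Rightarrow> real"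
  where "eta3 \<psi>0 \<psi> = eta_next \<psi>0 \<psi> (eta2 \<psi>0 \<psi>)"

definition eta4 :: "real \<Rightarrow> real \<Rightarrow> real \<Rightarrow> real"
  where "eta4 \<psi>0 \<psi> = eta_next \<psi>0 \<psi> (eta3 \<psi>0 \<psi>)"

text \<open>The sets on which the above formulas are defined, that is, on which no denominator
  vanishes.  They keep the values that come from \<open>x / 0 = 0\<close> from counting as zeros
  of \<open>H\<^sub>i = \<eta>\<^sub>i - 1\<close>.\<close>

definition eta1_dom :: "real \<Rightarrow> real \<Rightarrow> real set"
  where "eta1_dom \<psi>0 \<psi> = {0..<1 / \<psi>0}"

definition eta2_dom :: "real \<Rightarrow> real \<Rightarrow> real set"
  where "eta2_dom \<psi>0 \<psi> = {a \<in> eta1_dom \<psi>0 \<psi>. p_fun \<psi>0 \<psi> a \<noteq> 1}"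

definition eta3_dom :: "real \<Rightarrow> real \<Rightarrow> real set"
  where "eta3_dom \<psi>0 \<psi> = {a \<in> eta2_dom \<psi>0 \<psi>. \<psi>0 * eta2 \<psi>0 \<psi> a * a \<noteq> 1}"

definition eta4_dom :: "real \<Rightarrow> real \<Rightarrow> real set"
  where "eta4_dom \<psi>0 \<psi> = {a \<in> eta3_dom \<psi>0 \<psi>. \<psi>0 * eta3 \<psi>0 \<psi> a * a \<noteq> 1}"

definition smallest_pos_zero :: "real set \<Rightarrow> (real \<Rightarrow> real) \<Rightarrow> real"
  where "smallest_pos_zero S H = (LEAST a. a \<in> S \<and> 0 < a \<and> H a = 0)"

definition rho1 :: "real \<Rightarrow> real \<Rightarrow> real"
  where "rho1 \<psi>0 \<psi> = smallest_pos_zero (eta1_dom \<psi>0 \<psi>) (\<lambda>a. eta1 \<psi>0 \<psi> a - 1)"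

definition rho2 :: "real \<Rightarrow> real \<Rightarrow> real"
  where "rho2 \<psi>0 \<psi> = smallest_pos_zero (eta2_dom \<psi>0 \<psi>) (\<lambda>a. eta2 \<psi>0 \<psi> a - 1)"

definition rho3 :: "real \<Rightarrow> real \<Rightarrow> real"
  where "rho3 \<psi>0 \<psi> = smallest_pos_zero (eta3_dom \<psi>0 \<psi>) (\<lambda>a. eta3 \<psi>0 \<psi> a - 1)"

definition rho4 :: "real \<Rightarrow> real \<Rightarrow> real"
  where "rho4 \<psi>0 \<psi> = smallest_pos_zero (eta4_dom \<psi>0 \<psi>) (\<lambda>a. eta4 \<psi>0 \<psi> a - 1)"

definition radius :: "real \<Rightarrow> real \<Rightarrow> real"
  where "radius \<psi>0 \<psi> = Min {rho1 \<psi>0 \<psi>, rho2 \<psi>0 \<psi>, rho3 \<psi>0 \<psi>, rho4 \<psi>0 \<psi>}"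

section \<open>The iterative method\<close>

context
  fixes T :: "'x::banach \<Rightarrow> 'y::banach" and T' :: "'x \<Rightarrow> 'x \<Rightarrow>\<^sub>L 'y"
begin

definition y_step :: "'x \<Rightarrow> 'x"
  where "y_step x = x - (1 / 2) *\<^sub>R blinfun_apply (blinfun_inv (T' x)) (T x)"

definition z1_step :: "'x \<Rightarrow> 'x"
  where "z1_step x = x - blinfun_apply (blinfun_inv (T' (y_step x))) (T x)"

definition z2_step :: "'x \<Rightarrow> 'x"
  where "z2_step x = z1_step x -
    blinfun_apply (2 *\<^sub>R blinfun_inv (T' (y_step x)) - blinfun_inv (T' x)) (T (z1_step x))"

definition x_step :: "'x \<Rightarrow> 'x"
  where "x_step x = z2_step x -
    blinfun_apply (2 *\<^sub>R blinfun_inv (T' (y_step x)) - blinfun_inv (T' x)) (T (z2_step x))"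

definition iterate :: "'x \<Rightarrow> nat \<Rightarrow> 'x"
  where "iterate x0 n = (x_step ^^ n) x0"

text \<open>All operations in one step starting at \<open>x\<close> are legitimate: the operator and its
  derivative are only evaluated on their domain \<open>D\<close>, and only invertible derivatives
  are inverted.\<close>

definition step_well_defined :: "'x set \<Rightarrow> 'x \<Rightarrow> bool"
  where "step_well_defined D x \<longleftrightarrow>
    x \<in> D \<and> blinfun_invertible (T' x) \<and>
    y_step x \<in> D \<and> blinfun_invertible (T' (y_step x)) \<and>
    z1_step x \<in> D \<and> z2_step x \<in> D"

end

end

theory Submission
  imports Defs
begin

text \<open>
  Work with \<open>G \<circ> T\<close>, where \<open>G = [T'(x\<^sup>*)]\<^sup>-\<^sup>1\<close>, so that the derivative at \<open>x\<^sup>*\<close> becomes the identity.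
  The center condition makes \<open>T'(u)\<close> invertible when \<open>\<psi>\<^sub>0 \<parallel>u - x\<^sup>*\<parallel> < 1\<close> (Banach's lemma) and
  bounds \<open>G (T u)\<close>; the Lipschitz condition bounds the error of a Newton step at \<open>u\<close> and the
  difference of two inverse derivatives. The error of each substep of the method is a Newton error
  plus such differences applied to \<open>T u\<close>, and adding up the bounds gives exactly
  \<open>\<eta>\<^sub>i(\<parallel>x\<^sub>n - x\<^sup>*\<parallel>) \<parallel>x\<^sub>n - x\<^sup>*\<parallel>\<close>.

  Each \<open>\<eta>\<^sub>i\<close> is continuous on some \<open>[0, s\<^sub>i)\<close>, below \<open>1\<close> at \<open>0\<close>, and blows up at \<open>s\<^sub>i\<close>, where \<open>s\<^sub>i\<close>
  is the first point at which a denominator of \<open>\<eta>\<^sub>i\<close> vanishes. So \<open>\<eta>\<^sub>i\<close> first attains the value \<open>1\<close>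
  at \<open>\<rho>\<^sub>i < s\<^sub>i\<close> and is below \<open>1\<close> before. By compactness \<open>\<eta>\<^sub>4\<close> stays below some \<open>c < 1\<close> on
  \<open>[0, \<parallel>x\<^sub>0 - x\<^sup>*\<parallel>]\<close>, whence linear convergence.
\<close>

section \<open>The majorant functions\<close>

text \<open>Blow-up gives a point \<open>b\<close> with \<open>1 \<le> f b\<close>, so the part of
  \<open>{0..b}\<close> where \<open>1 \<le> f\<close> is compact and nonempty. Its least element is
  the crossing: \<open>f\<close> lies below 1 before it, so the point with value exactly 1 that the
  intermediate value theorem finds up to \<open>r\<close> can only be \<open>r\<close>.\<close>

lemma first_crossing:
  fixes f :: "real \<Rightarrow> real"
  assumes s: "0 < s" and cont: "continuous_on {0..<s} f" and f0: "f 0 < 1"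
    and lim: "filterlim f at_top (at_left s)"
  obtains r where "0 < r" "r < s" "f r = 1" "\<And>a. 0 \<le> a \<Longrightarrow> a < r \<Longrightarrow> f a < 1"
proof -
  have "eventually (\<lambda>a. 1 \<le> f a) (at_left s)"
    using lim by (simp add: filterlim_at_top)
  then obtain c where c: "c < s" "\<And>a. c < a \<Longrightarrow> a < s \<Longrightarrow> 1 \<le> f a"
    unfolding eventually_at_left_field by blast
  \<comment> \<open>The midpoint lies strictly beyond both \<open>c\<close> and 0 and strictly below
    \<open>s\<close>.\<close>
  define b where "b = (max c 0 + s) / 2"
  have b: "0 \<le> b" "b < s" "1 \<le> f b"
    using c s by (auto simp: b_def)
  have contb: "continuous_on {0..b} f"
    using cont by (rule continuous_on_subset) (use b in auto)
  let ?K = "{0..b} \<inter> f -` {1..}"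
  have "compact ?K"
    unfolding compact_eq_bounded_closed
    by (auto intro!: continuous_closed_preimage contb bounded_Int)
  moreover have "?K \<noteq> {}"
    using b by auto
  ultimately obtain r where r: "r \<in> ?K" "\<And>t. t \<in> ?K \<Longrightarrow> r \<le> t"
    by (meson compact_attains_inf)
  have below: "f a < 1" if "0 \<le> a" "a < r" for a
    using r(2)[of a] r(1) that by force
  have "\<exists>t\<ge>0. t \<le> r \<and> f t = 1"
    by (rule IVT') (use r f0 contb in \<open>auto intro: continuous_on_subset\<close>)
  then have "f r = 1"
    using below by (metis less_irrefl linorder_le_less_linear order_antisym_conv)
  moreover have "0 < r"
    using r(1) f0 by (cases "r = 0") auto
  ultimately show thesis
    using r(1) b below by (intro that[of r]) auto
qed

text \<open>Packs the hypotheses of \<open>first_crossing\<close> together with nonnegativity, so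
  that they can be handed on from each \<open>\<eta>\<close> to the next. Nothing is said about
  \<open>f\<close> at \<open>s\<close> or beyond, where the formulas may be singular.\<close>

definition majorant :: "(real \<Rightarrow> real) \<Rightarrow> real \<Rightarrow> bool"
  where "majorant f s \<longleftrightarrow> 0 < s \<and> continuous_on {0..<s} f \<and> f 0 < 1
    \<and> (\<forall>a\<in>{0..<s}. 0 \<le> f a) \<and> filterlim f at_top (at_left s)"

text \<open>The first crossing lies below \<open>s\<close>, hence in \<open>S\<close>, and
  \<open>f\<close> is less than 1 before it. Zeros that \<open>S\<close> may contain beyond the
  singularity are larger and do not affect the minimum.\<close>

lemma majorant_smallest_pos_zero:
  assumes f: "majorant f s" and S: "{0..<s} \<subseteq> S"
  defines "r \<equiv> smallest_pos_zero S (\<lambda>a. f a - 1)"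
  shows "0 < r" "r < s" "\<And>a. 0 \<le> a \<Longrightarrow> a < r \<Longrightarrow> f a < 1"
proof -
  obtain q where q: "0 < q" "q < s" "f q = 1" "\<And>a. 0 \<le> a \<Longrightarrow> a < q \<Longrightarrow> f a < 1"
    using f unfolding majorant_def by (blast elim: first_crossing)
  have "r = q"
    unfolding r_def smallest_pos_zero_def
  proof (rule Least_equality)
    fix a assume "a \<in> S \<and> 0 < a \<and> f a - 1 = 0"
    then show "q \<le> a"
      using q(4)[of a] by force
  qed (use q S in auto)
  then show "0 < r" "r < s" "\<And>a. 0 \<le> a \<Longrightarrow> a < r \<Longrightarrow> f a < 1"
    using q by auto
qed

text \<open>Locates the next singularity: with \<open>k = \<psi>0\<close>, the denominators
  \<open>1 - p_fun \<psi>0 \<psi> a\<close> and \<open>1 - \<psi>0 * \<eta> a * a\<close> first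
  vanish at such an \<open>r\<close>. The weighted function is 0 at 0 and inherits the blow-up of
  \<open>f\<close> because \<open>k * a\<close> tends to \<open>k * s > 0\<close>.\<close>

lemma majorant_weighted_crossing:
  assumes f: "majorant f s" and k: "0 < k"
  obtains r where "0 < r" "r < s" "k * f r * r = 1"
    "\<And>a. 0 \<le> a \<Longrightarrow> a < r \<Longrightarrow> k * f a * a < 1"
proof (rule first_crossing)
  show s: "0 < s" using f by (simp add: majorant_def)
  show "continuous_on {0..<s} (\<lambda>a. k * f a * a)"
    using f by (auto simp: majorant_def intro!: continuous_intros)
  have "filterlim (\<lambda>a. k * a * f a) at_top (at_left s)"
    by (rule filterlim_tendsto_pos_mult_at_top[of _ "k * s"])
      (use f k in \<open>auto simp: majorant_def intro!: tendsto_intros\<close>)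
  then show "filterlim (\<lambda>a. k * f a * a) at_top (at_left s)"
    by (simp add: mult_ac)
qed (use that in auto)

lemma filterlim_divide_vanishing_at_left:
  fixes u v :: "real \<Rightarrow> real"
  assumes s: "0 < s" and u: "(u \<longlongrightarrow> l) (at_left s)" "0 < l"
    and v: "(v \<longlongrightarrow> 0) (at_left s)" "\<And>a. 0 \<le> a \<Longrightarrow> a < s \<Longrightarrow> 0 < v a"
  shows "filterlim (\<lambda>a. u a / v a) at_top (at_left s)"
proof -
  have "eventually (\<lambda>a. 0 < v a) (at_left s)"
    using s v(2) unfolding eventually_at_left_field by (meson less_imp_le)
  then have "filterlim (\<lambda>a. inverse (v a)) at_top (at_left s)"
    by (rule filterlim_inverse_at_top[OF v(1)])
  then show ?thesis
    unfolding divide_inverse by (rule filterlim_tendsto_pos_mult_at_top[OF u])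
qed

lemma continuous_on_tendsto_at_left:
  fixes f :: "real \<Rightarrow> real"
  assumes "continuous_on {0..<s} f" "0 < r" "r < s"
  shows "(f \<longlongrightarrow> f r) (at_left r)"
proof -
  have "continuous (at r) f"
    by (rule continuous_on_interior[OF assms(1)]) (use assms in auto)
  then show ?thesis
    by (simp add: continuous_at_imp_continuous_within continuous_within[symmetric])
qed

section \<open>Singularities of the functions \<open>eta1\<close> to \<open>eta4\<close>, and the
  radius\<close>

context
  fixes \<psi>0 \<psi> :: real
  assumes psi: "0 < \<psi>0" "0 < \<psi>"
begin

lemma majorant_eta1: "majorant (eta1 \<psi>0 \<psi>) (1 / \<psi>0)"
  unfolding majorant_def
proof (intro conjI ballI)
  have less: "\<psi>0 * a < 1" if "a < 1 / \<psi>0" for a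
    using that psi by (simp add: field_simps)
  show "continuous_on {0..<1 / \<psi>0} (eta1 \<psi>0 \<psi>)"
    unfolding eta1_def using less by (fastforce intro!: continuous_intros)
  show "0 \<le> eta1 \<psi>0 \<psi> a" if "a \<in> {0..<1 / \<psi>0}" for a
    unfolding eta1_def using that psi less[of a] by auto
  have "filterlim (\<lambda>a. (\<psi> * a / 2 + (1 + \<psi>0 / 2 * a) / 2) / (1 - \<psi>0 * a)) at_top (at_left (1 / \<psi>0))"
  proof (rule filterlim_divide_vanishing_at_left)
    show "((\<lambda>a. \<psi> * a / 2 + (1 + \<psi>0 / 2 * a) / 2) \<longlongrightarrow> \<psi> * (1 / \<psi>0) / 2 + (1 + \<psi>0 / 2 * (1 / \<psi>0)) / 2)
        (at_left (1 / \<psi>0))"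
      by (intro tendsto_intros) auto
    have "((\<lambda>a. 1 - \<psi>0 * a) \<longlongrightarrow> 1 - \<psi>0 * (1 / \<psi>0)) (at_left (1 / \<psi>0))"
      by (intro tendsto_intros)
    then show "((\<lambda>a. 1 - \<psi>0 * a) \<longlongrightarrow> 0) (at_left (1 / \<psi>0))"
      using psi by simp
  qed (use psi less in \<open>auto intro!: add_pos_pos\<close>)
  then show "filterlim (eta1 \<psi>0 \<psi>) at_top (at_left (1 / \<psi>0))"
    by (simp add: eta1_def[abs_def])
qed (use psi in \<open>auto simp: eta1_def\<close>)

text \<open>Since \<open>eta1\<close> blows up at \<open>1 / \<psi>0\<close>, the value
  \<open>p_fun \<psi>0 \<psi> a\<close> reaches 1 strictly earlier. That point is the singularity
  \<open>s\<close> of \<open>eta2\<close>, which starts from the value 0.\<close>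

lemma majorant_eta2:
  obtains s where "0 < s" "s < 1 / \<psi>0" "\<And>a. 0 \<le> a \<Longrightarrow> a < s \<Longrightarrow> p_fun \<psi>0 \<psi> a < 1"
    "majorant (eta2 \<psi>0 \<psi>) s"
proof -
  obtain s where s: "0 < s" "s < 1 / \<psi>0" "p_fun \<psi>0 \<psi> s = 1"
      "\<And>a. 0 \<le> a \<Longrightarrow> a < s \<Longrightarrow> p_fun \<psi>0 \<psi> a < 1"
    unfolding p_fun_def using majorant_weighted_crossing[OF majorant_eta1 psi(1)] by blast
  have less: "\<psi>0 * a < 1" if "a < s" for a
    by (rule less_trans[of _ "\<psi>0 * s"]) (use that psi s(2) in \<open>auto simp: field_simps\<close>)
  have e1: "continuous_on {0..<1 / \<psi>0} (eta1 \<psi>0 \<psi>)" "\<And>a. 0 \<le> a \<Longrightarrow> a < s \<Longrightarrow> 0 \<le> eta1 \<psi>0 \<psi> a"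
    using majorant_eta1 s unfolding majorant_def by auto
  have e1s: "continuous_on {0..<s} (eta1 \<psi>0 \<psi>)"
    using e1(1) by (rule continuous_on_subset) (use s in auto)
  have "majorant (eta2 \<psi>0 \<psi>) s"
    unfolding majorant_def
  proof (intro conjI ballI)
    show "continuous_on {0..<s} (eta2 \<psi>0 \<psi>)"
      using less s(4) unfolding eta2_def p_fun_def
      by (intro continuous_intros e1s ballI) force+
    show "0 \<le> eta2 \<psi>0 \<psi> a" if "a \<in> {0..<s}" for a
      unfolding eta2_def using that psi less[of a] s(4)[of a] e1(2)[of a] by auto
    \<comment> \<open>A simpler minorant of \<open>eta2\<close> already blows up: the remaining
      factors are at least 1 and the remaining summand is nonnegative.\<close>
    have lim: "filterlim (\<lambda>a. \<psi> * a / (1 - p_fun \<psi>0 \<psi> a)) at_top (at_left s)"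
    proof (rule filterlim_divide_vanishing_at_left)
      have "((\<lambda>a. 1 - \<psi>0 * eta1 \<psi>0 \<psi> a * a) \<longlongrightarrow> 1 - \<psi>0 * eta1 \<psi>0 \<psi> s * s) (at_left s)"
        by (intro tendsto_intros continuous_on_tendsto_at_left[OF e1(1)] s)
      then show "((\<lambda>a. 1 - p_fun \<psi>0 \<psi> a) \<longlongrightarrow> 0) (at_left s)"
        using s(3) by (simp add: p_fun_def)
      show "((\<lambda>a. \<psi> * a) \<longlongrightarrow> \<psi> * s) (at_left s)"
        by (intro tendsto_intros)
    qed (use psi s in auto)
    have "\<psi> * a / (1 - p_fun \<psi>0 \<psi> a) \<le> eta2 \<psi>0 \<psi> a" if a: "0 < a" "a < s" for a
    proof -
      have "\<psi> * a / (1 - p_fun \<psi>0 \<psi> a) * (1 * 1)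
          \<le> \<psi> * a / (1 - p_fun \<psi>0 \<psi> a) * ((1 + eta1 \<psi>0 \<psi> a) * (\<psi>0 / 2 * a + 1))"
        using a psi s(4)[of a] e1(2)[of a] by (intro mult_left_mono mult_mono) auto
      also have "\<dots> = \<psi> * (1 + eta1 \<psi>0 \<psi> a) * (\<psi>0 / 2 * a + 1) * a / (1 - p_fun \<psi>0 \<psi> a)"
        by (simp add: ac_simps)
      also have "\<dots> \<le> \<psi> * a / 2 + \<dots>"
        using a psi by simp
      finally have 1: "\<psi> * a / (1 - p_fun \<psi>0 \<psi> a) \<le> \<psi> * a / 2
          + \<psi> * (1 + eta1 \<psi>0 \<psi> a) * (\<psi>0 / 2 * a + 1) * a / (1 - p_fun \<psi>0 \<psi> a)" (is "_ \<le> ?r")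
        by simp
      have "0 \<le> \<psi> * a / (1 - p_fun \<psi>0 \<psi> a)"
        using a psi s(4)[of a] by simp
      with 1 have "0 \<le> ?r" by linarith
      moreover have "1 \<le> 1 / (1 - \<psi>0 * a)"
        using a psi less[of a] by simp
      ultimately have "1 * ?r \<le> eta2 \<psi>0 \<psi> a"
        unfolding eta2_def by (intro mult_right_mono)
      with 1 show ?thesis by simp
    qed
    then show "filterlim (eta2 \<psi>0 \<psi>) at_top (at_left s)"
      using s(1) by (intro filterlim_at_top_mono[OF lim])
        (auto simp: eventually_at_left_field intro!: exI[of _ 0])
  qed (use s in \<open>auto simp: eta2_def\<close>)
  then show thesis using s by (intro that[of s]) auto
qed

text \<open>The new singularity \<open>r\<close>, where \<open>\<psi>0 * f r * r = 1\<close>, comes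
  before the old one. On \<open>{0..<r}\<close> all three kinds of denominators are positive, and
  every summand vanishes at 0.\<close>

lemma majorant_eta_next:
  assumes f: "majorant f s" and s: "s \<le> 1 / \<psi>0"
    and p: "\<And>a. 0 \<le> a \<Longrightarrow> a < s \<Longrightarrow> p_fun \<psi>0 \<psi> a < 1"
  obtains r where "0 < r" "r < s" "\<And>a. 0 \<le> a \<Longrightarrow> a < r \<Longrightarrow> \<psi>0 * f a * a < 1"
    "majorant (eta_next \<psi>0 \<psi> f) r"
proof -
  obtain r where r: "0 < r" "r < s" "\<psi>0 * f r * r = 1"
      "\<And>a. 0 \<le> a \<Longrightarrow> a < r \<Longrightarrow> \<psi>0 * f a * a < 1"
    using majorant_weighted_crossing[OF f psi(1)] by blast
  have less: "\<psi>0 * a < 1" if "a < r" for a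
    by (rule less_le_trans[of _ "\<psi>0 * s"]) (use that psi s r(2) in \<open>auto simp: field_simps\<close>)
  have p: "p_fun \<psi>0 \<psi> a < 1" if "0 \<le> a" "a < r" for a
    using p[of a] that r by simp
  have e1: "continuous_on {0..<r} (eta1 \<psi>0 \<psi>)" "\<And>a. 0 \<le> a \<Longrightarrow> a < r \<Longrightarrow> 0 \<le> eta1 \<psi>0 \<psi> a"
    using majorant_eta1 s r unfolding majorant_def
    by (auto intro: continuous_on_subset)
  have fs: "continuous_on {0..<s} f" and f_nonneg: "\<And>a. 0 \<le> a \<Longrightarrow> a < r \<Longrightarrow> 0 \<le> f a"
    using f r unfolding majorant_def by auto
  have fr: "continuous_on {0..<r} f"
    using fs by (rule continuous_on_subset) (use r in auto)
  \<comment> \<open>Keeps the limit of the numerator positive in the blow-up argument.\<close>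
  have f_pos: "0 < f r"
    using r(1,3) psi by (metis zero_less_mult_pos zero_less_mult_pos2 zero_less_one)
  have "majorant (eta_next \<psi>0 \<psi> f) r"
    unfolding majorant_def
  proof (intro conjI ballI)
    show "continuous_on {0..<r} (eta_next \<psi>0 \<psi> f)"
      using less r(4) p unfolding eta_next_def p_fun_def
      by (fastforce intro!: continuous_intros e1 fr)
    show "0 \<le> eta_next \<psi>0 \<psi> f a" if "a \<in> {0..<r}" for a
      unfolding eta_next_def
      using that psi less[of a] r(4)[of a] e1(2)[of a] f_nonneg[of a] p[of a]
      by (intro mult_nonneg_nonneg add_nonneg_nonneg divide_nonneg_nonneg) auto
    \<comment> \<open>The first summand, multiplied by the outer factor \<open>f a\<close>, blows up
      by itself; the other summands are nonnegative.\<close>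
    have lim: "filterlim (\<lambda>a. \<psi> * f a * a * f a / (2 * (1 - \<psi>0 * f a * a))) at_top (at_left r)"
    proof (rule filterlim_divide_vanishing_at_left)
      have "((\<lambda>a. 2 * (1 - \<psi>0 * f a * a)) \<longlongrightarrow> 2 * (1 - \<psi>0 * f r * r)) (at_left r)"
        by (intro tendsto_intros continuous_on_tendsto_at_left[OF fs] r)
      then show "((\<lambda>a. 2 * (1 - \<psi>0 * f a * a)) \<longlongrightarrow> 0) (at_left r)"
        using r(3) by simp
      show "((\<lambda>a. \<psi> * f a * a * f a) \<longlongrightarrow> \<psi> * f r * r * f r) (at_left r)"
        by (intro tendsto_intros continuous_on_tendsto_at_left[OF fs] r)
      show "0 < 2 * (1 - \<psi>0 * f a * a)" if "0 \<le> a" "a < r" for a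
        using r(4)[OF that] by simp
    qed (use psi r(1) f_pos in auto)
    have "\<psi> * f a * a * f a / (2 * (1 - \<psi>0 * f a * a)) \<le> eta_next \<psi>0 \<psi> f a" if a: "0 < a" "a < r" for a
    proof -
      have "\<psi> * f a * a / (2 * (1 - \<psi>0 * f a * a)) * f a \<le> eta_next \<psi>0 \<psi> f a"
        unfolding eta_next_def add.assoc
        using a psi less[of a] r(4)[of a] e1(2)[of a] f_nonneg[of a] p[of a]
        by (intro mult_right_mono add_increasing2 order_refl mult_nonneg_nonneg
            add_nonneg_nonneg divide_nonneg_nonneg) auto
      then show ?thesis by simp
    qed
    then show "filterlim (eta_next \<psi>0 \<psi> f) at_top (at_left r)"
      using r(1) by (intro filterlim_at_top_mono[OF lim])
        (auto simp: eventually_at_left_field intro!: exI[of _ 0])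
  qed (use r in \<open>auto simp: eta_next_def\<close>)
  then show thesis using r by (intro that[of r]) auto
qed

text \<open>The singularities are nested, \<open>s4 < s3 < s2 < 1 / \<psi>0\<close>, so each
  \<open>{0..<s}\<close> avoids all poles of its function and lies in the corresponding domain. Each
  first zero lies below its own singularity, and the radius is at most each of them.\<close>

lemma radius_properties:
  shows "0 < radius \<psi>0 \<psi>" "radius \<psi>0 \<psi> < 1 / \<psi>0"
    "continuous_on {0..<radius \<psi>0 \<psi>} (eta4 \<psi>0 \<psi>)"
    "\<And>a. 0 \<le> a \<Longrightarrow> a < radius \<psi>0 \<psi> \<Longrightarrow>
      eta1 \<psi>0 \<psi> a \<in> {0..<1} \<and> eta2 \<psi>0 \<psi> a \<in> {0..<1} \<and> eta3 \<psi>0 \<psi> a \<in> {0..<1} \<and> eta4 \<psi>0 \<psi> a \<in> {0..<1}"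
proof -
  obtain s2 where s2: "0 < s2" "s2 < 1 / \<psi>0" "\<And>a. 0 \<le> a \<Longrightarrow> a < s2 \<Longrightarrow> p_fun \<psi>0 \<psi> a < 1"
      "majorant (eta2 \<psi>0 \<psi>) s2"
    using majorant_eta2 by blast
  obtain s3 where s3: "0 < s3" "s3 < s2" "\<And>a. 0 \<le> a \<Longrightarrow> a < s3 \<Longrightarrow> \<psi>0 * eta2 \<psi>0 \<psi> a * a < 1"
      "majorant (eta3 \<psi>0 \<psi>) s3"
    unfolding eta3_def using majorant_eta_next[OF s2(4) less_imp_le[OF s2(2)] s2(3)] by blast
  obtain s4 where s4: "0 < s4" "s4 < s3" "\<And>a. 0 \<le> a \<Longrightarrow> a < s4 \<Longrightarrow> \<psi>0 * eta3 \<psi>0 \<psi> a * a < 1"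
      "majorant (eta4 \<psi>0 \<psi>) s4"
    unfolding eta4_def
    using majorant_eta_next[OF s3(4) less_imp_le[OF less_trans[OF s3(2) s2(2)]]
      s2(3)[OF _ less_trans[OF _ s3(2)]]] by blast
  have dom1: "{0..<1 / \<psi>0} \<subseteq> eta1_dom \<psi>0 \<psi>"
    by (auto simp: eta1_dom_def)
  have dom2: "{0..<s2} \<subseteq> eta2_dom \<psi>0 \<psi>"
    using s2(2) s2(3)[THEN less_imp_neq] dom1 unfolding eta2_dom_def by fastforce
  have dom3: "{0..<s3} \<subseteq> eta3_dom \<psi>0 \<psi>"
    using s3(2) s3(3)[THEN less_imp_neq] dom2 unfolding eta3_dom_def by fastforce
  have dom4: "{0..<s4} \<subseteq> eta4_dom \<psi>0 \<psi>"
    using s4(2) s4(3)[THEN less_imp_neq] dom3 unfolding eta4_dom_def by fastforce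
  note r1 = majorant_smallest_pos_zero[OF majorant_eta1 dom1, folded rho1_def]
  note r2 = majorant_smallest_pos_zero[OF s2(4) dom2, folded rho2_def]
  note r3 = majorant_smallest_pos_zero[OF s3(4) dom3, folded rho3_def]
  note r4 = majorant_smallest_pos_zero[OF s4(4) dom4, folded rho4_def]
  note m = majorant_eta1 s2(4) s3(4) s4(4)
  show "0 < radius \<psi>0 \<psi>"
    using r1(1) r2(1) r3(1) r4(1) by (simp add: radius_def)
  show "radius \<psi>0 \<psi> < 1 / \<psi>0"
    using r1(2) by (simp add: radius_def)
  have "continuous_on {0..<s4} (eta4 \<psi>0 \<psi>)"
    using s4(4) by (simp add: majorant_def)
  then show "continuous_on {0..<radius \<psi>0 \<psi>} (eta4 \<psi>0 \<psi>)"
    by (rule continuous_on_subset) (use r4(2) in \<open>auto simp: radius_def\<close>)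
  show "eta1 \<psi>0 \<psi> a \<in> {0..<1} \<and> eta2 \<psi>0 \<psi> a \<in> {0..<1} \<and> eta3 \<psi>0 \<psi> a \<in> {0..<1} \<and> eta4 \<psi>0 \<psi> a \<in> {0..<1}"
    if a: "0 \<le> a" "a < radius \<psi>0 \<psi>" for a
  proof -
    have "a < rho1 \<psi>0 \<psi>" "a < rho2 \<psi>0 \<psi>" "a < rho3 \<psi>0 \<psi>" "a < rho4 \<psi>0 \<psi>"
      using a by (auto simp: radius_def)
    then show ?thesis
      using a r1 r2 r3 r4 m unfolding majorant_def by auto
  qed
qed

end

section \<open>Operator estimates\<close>

lemma blinfun_inverse_of_apply:
  assumes "blinfun_inverse_of A B"
  shows "blinfun_apply A (blinfun_apply B v) = v" "blinfun_apply B (blinfun_apply A w) = w"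
  using assms unfolding blinfun_inverse_of_def
  by (metis blinfun_apply_blinfun_compose blinfun_apply_id_blinfun)+

lemma blinfun_inverse_ofI:
  assumes "\<And>v. blinfun_apply A (blinfun_apply B v) = v" "\<And>w. blinfun_apply B (blinfun_apply A w) = w"
  shows "blinfun_inverse_of A B"
  unfolding blinfun_inverse_of_def using assms by (auto intro!: blinfun_eqI)

lemma blinfun_inverse_of_inv:
  assumes "blinfun_invertible A"
  shows "blinfun_inverse_of A (blinfun_inv A)"
  using assms unfolding blinfun_invertible_def by (metis blinfun_inv_eqI)

text \<open>Banach's lemma by fixed points: solving \<open>u + K u = v\<close> means finding the
  fixed point of the contraction that sends \<open>u\<close> to \<open>v - K u\<close>. Uniqueness
  makes the solution map \<open>g\<close> linear, and
  \<open>norm (g v) \<le> norm v + k * norm (g v)\<close> gives the bound.\<close>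

lemma blinfun_inverse_of_id_plus:
  fixes K :: "'a::banach \<Rightarrow>\<^sub>L 'a"
  assumes K: "norm K \<le> k" "k < 1"
  obtains B where "blinfun_inverse_of (id_blinfun + K) B" "norm B \<le> 1 / (1 - k)"
proof -
  have k: "0 \<le> k" using K norm_ge_zero order_trans by blast
  have Kv: "norm (K v) \<le> k * norm v" for v
    using norm_blinfun[of K v] K(1) by (meson mult_right_mono norm_ge_zero order_trans)
  have "\<exists>!u. v - K u = u" for v
  proof (rule banach_fix_type[OF k K(2)], intro allI)
    fix u w
    have "dist (v - K u) (v - K w) = norm (K (u - w))"
      by (simp add: dist_norm blinfun.diff_right norm_minus_commute)
    then show "dist (v - K u) (v - K w) \<le> k * dist u w"
      using Kv[of "u - w"] by (simp add: dist_norm)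
  qed
  then obtain g where g: "\<And>v. v - K (g v) = g v" and unique: "\<And>v u. v - K u = u \<Longrightarrow> u = g v"
    by metis
  have bound: "norm (g v) \<le> norm v * (1 / (1 - k))" for v
  proof -
    have "norm (g v) \<le> norm v + norm (K (g v))"
      using g[of v] norm_triangle_ineq4[of v "K (g v)"] by simp
    then have "norm (g v) * (1 - k) \<le> norm v"
      using Kv[of "g v"] by (simp add: algebra_simps)
    then show ?thesis
      using K(2) by (simp add: field_simps)
  qed
  have "bounded_linear g"
  proof (rule bounded_linear_intro[OF _ _ bound])
    fix v w :: 'a and c :: real
    show "g (v + w) = g v + g w"
      using g[of v] g[of w] by (intro unique[symmetric]) (simp add: blinfun.add_right algebra_simps)
    show "g (c *\<^sub>R v) = c *\<^sub>R g v"
      using g[of v] by (intro unique[symmetric]) (metis blinfun.scaleR_right scaleR_diff_right)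
  qed
  then have B: "blinfun_apply (Blinfun g) = g"
    by (rule bounded_linear_Blinfun_apply)
  show thesis
  proof (rule that)
    show "blinfun_inverse_of (id_blinfun + K) (Blinfun g)"
    proof (rule blinfun_inverse_ofI)
      show "(id_blinfun + K) (Blinfun g v) = v" for v
        unfolding B using g[of v] by (simp add: blinfun.add_left algebra_simps)
      show "Blinfun g ((id_blinfun + K) w) = w" for w
        unfolding B by (rule unique[symmetric]) (simp add: blinfun.add_left)
    qed
    show "norm (Blinfun g) \<le> 1 / (1 - k)"
      by (rule norm_blinfun_bound) (use B bound K(2) in \<open>auto simp: mult.commute\<close>)
  qed
qed

text \<open>In the applications \<open>M\<close> is the derivative at \<open>u\<close>. A deviation
  growing like \<open>t * K\<close> along the segment contributes \<open>K / 2\<close> after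
  integration; here this is done by the mean value inequality.\<close>

lemma first_order_taylor_bound:
  fixes F :: "'a::real_normed_vector \<Rightarrow> 'b::real_normed_vector" and F' :: "'a \<Rightarrow> 'a \<Rightarrow>\<^sub>L 'b"
  assumes deriv: "\<And>t. 0 \<le> t \<Longrightarrow> t \<le> 1 \<Longrightarrow>
      (F has_derivative blinfun_apply (F' (u + t *\<^sub>R h))) (at (u + t *\<^sub>R h))"
    and bound: "\<And>t. 0 \<le> t \<Longrightarrow> t \<le> 1 \<Longrightarrow> norm (F' (u + t *\<^sub>R h) - M) \<le> t * K"
  shows "norm (F (u + h) - F u - blinfun_apply M h) \<le> K / 2 * norm h"
proof -
  define f where "f t = F (u + t *\<^sub>R h) - t *\<^sub>R M h" for t
  have der: "(f has_vector_derivative (F' (u + t *\<^sub>R h) h - M h)) (at t)"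
    if t: "0 \<le> t" "t \<le> 1" for t
  proof -
    have "((\<lambda>t. F (u + t *\<^sub>R h)) has_derivative (\<lambda>s. F' (u + t *\<^sub>R h) (s *\<^sub>R h))) (at t)"
      by (rule has_derivative_compose[where f = "\<lambda>t. u + t *\<^sub>R h" and g = F
          and s = UNIV, OF _ deriv[OF t]])
        (auto intro!: derivative_eq_intros)
    then have "(f has_derivative (\<lambda>s. F' (u + t *\<^sub>R h) (s *\<^sub>R h) - s *\<^sub>R M h)) (at t)"
      unfolding f_def by (auto intro!: derivative_eq_intros)
    then show ?thesis
      by (simp add: has_vector_derivative_def blinfun.scaleR_right scaleR_diff_right)
  qed
  \<comment> \<open>The comparison function is \<open>K * norm h * t\<^sup>2 / 2\<close>, whose
    derivative dominates that of \<open>f\<close>.\<close>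
  have "norm (f 1 - f 0) \<le> K * norm h * 1\<^sup>2 / 2 - K * norm h * 0\<^sup>2 / 2"
  proof (rule differentiable_bound_general[where \<phi>' = "\<lambda>t. K * norm h * t"])
    show "continuous_on {0..1} f"
      by (intro continuous_at_imp_continuous_on ballI has_vector_derivative_continuous[OF der]) auto
    fix t :: real assume t: "0 < t" "t < 1"
    show "(f has_vector_derivative (F' (u + t *\<^sub>R h) h - M h)) (at t)"
      using der t by simp
    show "((\<lambda>t. K * norm h * t\<^sup>2 / 2) has_vector_derivative K * norm h * t) (at t)"
      by (auto intro!: derivative_eq_intros simp: has_real_derivative_iff_has_vector_derivative[symmetric])
    have "norm ((F' (u + t *\<^sub>R h) - M) h) \<le> t * K * norm h"
      by (rule order_trans[OF norm_blinfun]) (use bound[of t] t in \<open>simp add: mult_right_mono\<close>)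
    then show "norm (F' (u + t *\<^sub>R h) h - M h) \<le> K * norm h * t"
      by (simp add: blinfun.diff_left mult_ac)
  qed (auto intro!: continuous_intros)
  then show ?thesis
    by (simp add: f_def algebra_simps)
qed

section \<open>Local convergence\<close>

locale local_convergence =
  fixes D :: "'x::banach set" and T :: "'x \<Rightarrow> 'y::banach" and T' :: "'x \<Rightarrow> 'x \<Rightarrow>\<^sub>L 'y"
    and \<psi>0 \<psi> :: real and xs :: 'x
  assumes convex: "convex D"
    and deriv: "u \<in> D \<Longrightarrow> (T has_derivative blinfun_apply (T' u)) (at u)"
    and psi: "0 < \<psi>0" "0 < \<psi>"
    and xs: "xs \<in> D" "T xs = 0" "blinfun_invertible (T' xs)"
    and center_lipschitz: "u \<in> D \<Longrightarrow>
      norm (blinfun_inv (T' xs) o\<^sub>L (T' u - T' xs)) \<le> \<psi>0 * norm (u - xs)"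
    and lipschitz: "u \<in> D \<Longrightarrow> v \<in> D \<Longrightarrow>
      norm (blinfun_inv (T' xs) o\<^sub>L (T' u - T' v)) \<le> \<psi> * norm (u - v)"
begin

abbreviation G :: "'y \<Rightarrow>\<^sub>L 'x" where "G \<equiv> blinfun_inv (T' xs)"
abbreviation B :: "'x \<Rightarrow> 'y \<Rightarrow>\<^sub>L 'x" where "B u \<equiv> blinfun_inv (T' u)"

section \<open>Inverse derivatives, Taylor remainders and Newton errors\<close>

lemmas G_inverse = blinfun_inverse_of_apply[OF blinfun_inverse_of_inv[OF xs(3)]]

text \<open>Banach's lemma applies to \<open>G o\<^sub>L T' u\<close>, which is the identity plus
  \<open>K\<close>. The bound is in terms of \<open>G v\<close> rather than \<open>v\<close>, so
  only \<open>G\<close> composed with \<open>T\<close> and with differences of \<open>T'\<close>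
  ever needs estimating.\<close>

lemma
  assumes u: "u \<in> D" "\<psi>0 * norm (u - xs) < 1"
  shows invertible: "blinfun_invertible (T' u)"
    and norm_B: "norm (B u v) \<le> norm (G v) / (1 - \<psi>0 * norm (u - xs))"
proof -
  define K where "K = G o\<^sub>L (T' u - T' xs)"
  obtain C where C: "blinfun_inverse_of (id_blinfun + K) C" "norm C \<le> 1 / (1 - \<psi>0 * norm (u - xs))"
    using blinfun_inverse_of_id_plus center_lipschitz u unfolding K_def by blast
  have K: "(id_blinfun + K) w = G (T' u w)" for w
    by (simp add: K_def blinfun.add_left blinfun.diff_left blinfun.diff_right G_inverse)
  \<comment> \<open>\<open>C\<close> inverts \<open>G o\<^sub>L T' u\<close>, so composing it with
    \<open>G\<close> inverts \<open>T' u\<close>; injectivity of \<open>G\<close> turns the right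
    inverse property into one for \<open>T' u\<close>.\<close>
  have inv: "blinfun_inverse_of (T' u) (C o\<^sub>L G)"
  proof (rule blinfun_inverse_ofI)
    show "T' u ((C o\<^sub>L G) v) = v" for v
      using blinfun_inverse_of_apply(1)[OF C(1), of "G v"] K[of "C (G v)"] G_inverse(1)
      by (metis blinfun_apply_blinfun_compose)
    show "(C o\<^sub>L G) (T' u w) = w" for w
      using blinfun_inverse_of_apply(2)[OF C(1), of w] K[of w] by simp
  qed
  then show "blinfun_invertible (T' u)"
    unfolding blinfun_invertible_def by blast
  have "B u v = C (G v)"
    using blinfun_inv_eqI[OF inv] by simp
  then have "norm (B u v) \<le> norm C * norm (G v)"
    using norm_blinfun by simp
  also have "\<dots> \<le> 1 / (1 - \<psi>0 * norm (u - xs)) * norm (G v)"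
    by (intro mult_right_mono C) simp
  finally show "norm (B u v) \<le> norm (G v) / (1 - \<psi>0 * norm (u - xs))"
    by simp
qed

lemma B_inverse:
  assumes "u \<in> D" "\<psi>0 * norm (u - xs) < 1"
  shows "T' u (B u v) = v" "B u (T' u w) = w"
  using blinfun_inverse_of_apply[OF blinfun_inverse_of_inv[OF invertible[OF assms]]] by auto

lemma has_derivative_G:
  assumes "u \<in> D"
  shows "((\<lambda>u. G (T u)) has_derivative blinfun_apply (G o\<^sub>L T' u)) (at u)"
  using has_derivative_compose[OF deriv[OF assms]
    bounded_linear_imp_has_derivative[OF blinfun.bounded_linear_right, of G]]
  by (simp add: blinfun_compose.rep_eq o_def)

lemma segment_in_D:
  assumes "u \<in> D" "v \<in> D" "0 \<le> t" "t \<le> 1"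
  shows "u + t *\<^sub>R (v - u) \<in> D"
  using convexD_alt[OF convex assms] by (simp add: algebra_simps)

text \<open>Taylor expansion at \<open>xs\<close>, where \<open>G\<close> composed with
  \<open>T\<close> vanishes and has the identity as derivative. It serves both the size bound
  \<open>norm_G_T\<close> and the uniqueness of the zero.\<close>

lemma G_T_deviation:
  assumes u: "u \<in> D"
  shows "norm (G (T u) - (u - xs)) \<le> \<psi>0 / 2 * norm (u - xs) * norm (u - xs)"
proof -
  have "norm (G (T (xs + (u - xs))) - G (T xs) - id_blinfun (u - xs))
      \<le> (\<psi>0 * norm (u - xs)) / 2 * norm (u - xs)"
  proof (rule first_order_taylor_bound[where F' = "\<lambda>u. G o\<^sub>L T' u" and F = "\<lambda>u. G (T u)"])
    fix t :: real assume t: "0 \<le> t" "t \<le> 1"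
    have D: "xs + t *\<^sub>R (u - xs) \<in> D"
      using segment_in_D[OF xs(1) u t] .
    show "((\<lambda>u. G (T u)) has_derivative blinfun_apply (G o\<^sub>L T' (xs + t *\<^sub>R (u - xs)))) (at (xs + t *\<^sub>R (u - xs)))"
      using has_derivative_G[OF D] .
    have "(G o\<^sub>L T' (xs + t *\<^sub>R (u - xs))) - id_blinfun = G o\<^sub>L (T' (xs + t *\<^sub>R (u - xs)) - T' xs)"
      by (rule blinfun_eqI) (simp add: blinfun.diff_left blinfun.diff_right G_inverse)
    then show "norm ((G o\<^sub>L T' (xs + t *\<^sub>R (u - xs))) - id_blinfun) \<le> t * (\<psi>0 * norm (u - xs))"
      using center_lipschitz[OF D] t by (simp add: mult_ac)
  qed
  then show ?thesis
    by (simp add: xs(2) blinfun.zero_right)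
qed

lemma norm_G_T:
  assumes u: "u \<in> D"
  shows "norm (G (T u)) \<le> (1 + \<psi>0 / 2 * norm (u - xs)) * norm (u - xs)"
  using G_T_deviation[OF u] norm_triangle_sub[of "G (T u)" "u - xs"]
  by (simp add: algebra_simps)

text \<open>Since \<open>T xs = 0\<close>, the error is \<open>B u\<close> applied to the Taylor
  remainder from \<open>u\<close> to \<open>xs\<close>. The expansion is based at \<open>u\<close>,
  hence the Lipschitz constant \<open>\<psi>\<close> in the numerator; \<open>\<psi>0\<close> enters
  through the inverse.\<close>

lemma newton_error:
  assumes u: "u \<in> D" "\<psi>0 * norm (u - xs) < 1"
  shows "norm (u - xs - B u (T u)) \<le> \<psi> * norm (u - xs) * norm (u - xs) / (2 * (1 - \<psi>0 * norm (u - xs)))"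
proof -
  have "norm (G (T (u + (xs - u))) - G (T u) - (G o\<^sub>L T' u) (xs - u))
      \<le> (\<psi> * norm (xs - u)) / 2 * norm (xs - u)"
  proof (rule first_order_taylor_bound[where F' = "\<lambda>u. G o\<^sub>L T' u" and F = "\<lambda>u. G (T u)"])
    fix t :: real assume t: "0 \<le> t" "t \<le> 1"
    have D: "u + t *\<^sub>R (xs - u) \<in> D"
      using segment_in_D[OF u(1) xs(1) t] .
    show "((\<lambda>u. G (T u)) has_derivative blinfun_apply (G o\<^sub>L T' (u + t *\<^sub>R (xs - u)))) (at (u + t *\<^sub>R (xs - u)))"
      using has_derivative_G[OF D] .
    have "(G o\<^sub>L T' (u + t *\<^sub>R (xs - u))) - (G o\<^sub>L T' u) = G o\<^sub>L (T' (u + t *\<^sub>R (xs - u)) - T' u)"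
      by (rule blinfun_eqI) (simp add: blinfun.diff_left blinfun.diff_right)
    then show "norm ((G o\<^sub>L T' (u + t *\<^sub>R (xs - u))) - (G o\<^sub>L T' u)) \<le> t * (\<psi> * norm (xs - u))"
      using lipschitz[OF D u(1)] t by (simp add: mult_ac)
  qed
  moreover have "G (T (u + (xs - u))) - G (T u) - (G o\<^sub>L T' u) (xs - u) = G (T' u (u - xs) - T u)"
    by (simp add: xs(2) blinfun.zero_right blinfun.diff_right)
  ultimately have 1: "norm (G (T' u (u - xs) - T u)) \<le> \<psi> * norm (u - xs) * norm (u - xs) / 2"
    by (metis norm_minus_commute times_divide_eq_left)
  have "u - xs - B u (T u) = B u (T' u (u - xs) - T u)"
    using B_inverse(2)[OF u, of "u - xs"] by (simp add: blinfun.diff_right)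
  then have "norm (u - xs - B u (T u)) \<le> norm (G (T' u (u - xs) - T u)) / (1 - \<psi>0 * norm (u - xs))"
    using norm_B[OF u] by simp
  also have "\<dots> \<le> (\<psi> * norm (u - xs) * norm (u - xs) / 2) / (1 - \<psi>0 * norm (u - xs))"
    by (rule divide_right_mono[OF 1]) (use u in simp)
  finally show ?thesis
    by simp
qed

text \<open>Rests on the identity \<open>B u - B w = B u (T' w - T' u) B w\<close>. Distances are
  measured through \<open>xs\<close>, which produces sums such as
  \<open>eta1 \<psi>0 \<psi> a + \<eta> a\<close>; \<open>q\<close> and \<open>d\<close> are free
  upper bounds so that majorants can be inserted directly.\<close>

lemma norm_B_diff:
  assumes u: "u \<in> D" "\<psi>0 * norm (u - xs) < 1" and w: "w \<in> D" "\<psi>0 * norm (w - xs) < 1"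
    and r: "\<psi>0 * norm (w - xs) \<le> q" "q < 1" and d: "norm (u - xs) + norm (w - xs) \<le> d"
  shows "norm (B u v - B w v) \<le> \<psi> * d / (1 - \<psi>0 * norm (u - xs)) * (1 / (1 - q)) * norm (G v)"
proof -
  have "B u v - B w v = B u ((T' w - T' u) (B w v))"
    by (simp add: blinfun.diff_left blinfun.diff_right B_inverse[OF u] B_inverse[OF w])
  then have "norm (B u v - B w v) \<le> norm ((G o\<^sub>L (T' w - T' u)) (B w v)) / (1 - \<psi>0 * norm (u - xs))"
    using norm_B[OF u] by simp
  also have "\<dots> \<le> \<psi> * d * (norm (G v) / (1 - q)) / (1 - \<psi>0 * norm (u - xs))"
  proof (rule divide_right_mono)
    have "norm (w - u) \<le> d"
      using norm_triangle_ineq4[of "w - xs" "u - xs"] d by simp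
    then have "norm (G o\<^sub>L (T' w - T' u)) \<le> \<psi> * d"
      using lipschitz[OF w(1) u(1)] psi(2) by (meson mult_left_mono less_imp_le order_trans)
    moreover have "norm (B w v) \<le> norm (G v) / (1 - q)"
      by (rule order_trans[OF norm_B[OF w]]) (use r in \<open>auto intro!: divide_left_mono\<close>)
    moreover have "0 \<le> d"
      using d norm_ge_zero[of "u - xs"] norm_ge_zero[of "w - xs"] by linarith
    ultimately show "norm ((G o\<^sub>L (T' w - T' u)) (B w v)) \<le> \<psi> * d * (norm (G v) / (1 - q))"
      using psi by (intro order_trans[OF norm_blinfun[of "G o\<^sub>L (T' w - T' u)"]] mult_mono) auto
  qed (use u in simp)
  finally show ?thesis
    by (simp add: mult_ac)
qed

section \<open>Error bounds for the substeps\<close>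

text \<open>The half step leaves the Newton error plus half of the Newton correction; these are the
  two summands of \<open>eta1\<close>.\<close>

lemma y_step_error:
  fixes x defines "a \<equiv> norm (x - xs)"
  assumes x: "x \<in> D" "\<psi>0 * a < 1"
  shows "norm (y_step T T' x - xs) \<le> eta1 \<psi>0 \<psi> a * a"
proof -
  note x = x[unfolded a_def]
  have eq: "y_step T T' x - xs = (x - xs - B x (T x)) + (1/2) *\<^sub>R B x (T x)"
    by (simp add: y_step_def algebra_simps flip: scaleR_left.add)
  have "norm (y_step T T' x - xs) \<le> norm (x - xs - B x (T x)) + norm ((1/2) *\<^sub>R B x (T x))"
    unfolding eq by (rule norm_triangle_ineq)
  also have "norm ((1/2) *\<^sub>R B x (T x)) = norm (B x (T x)) / 2"
    by simp
  also have "norm (x - xs - B x (T x)) \<le> \<psi> * a * a / (2 * (1 - \<psi>0 * a))"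
    using newton_error[OF x] by (simp add: a_def)
  also have "norm (B x (T x)) \<le> (1 + \<psi>0 / 2 * a) * a / (1 - \<psi>0 * a)"
    unfolding a_def
    by (rule order_trans[OF norm_B[OF x] divide_right_mono[OF norm_G_T]]) (use x in auto)
  also have "\<psi> * a * a / (2 * (1 - \<psi>0 * a)) + (1 + \<psi>0 / 2 * a) * a / (1 - \<psi>0 * a) / 2 = eta1 \<psi>0 \<psi> a * a"
  proof -
    \<comment> \<open>The denominator is made opaque for the field arithmetic; for
      \<open>A = 0\<close> both sides are 0 because \<open>x / 0 = 0\<close>.\<close>
    define A where "A = 1 - \<psi>0 * a"
    show ?thesis
      unfolding eta1_def A_def[symmetric] by (cases "A = 0") (auto simp: field_simps)
  qed
  finally show ?thesis by simp
qed

text \<open>Newton error at \<open>x\<close>, plus the effect on \<open>T x\<close> of inverting the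
  derivative at \<open>y\<close> instead of \<open>x\<close>; these are the two summands of
  \<open>eta2\<close>.\<close>

lemma z1_step_error:
  fixes x defines "a \<equiv> norm (x - xs)"
  assumes x: "x \<in> D" "\<psi>0 * a < 1" and y: "y_step T T' x \<in> D" and p: "p_fun \<psi>0 \<psi> a < 1"
  shows "norm (z1_step T T' x - xs) \<le> eta2 \<psi>0 \<psi> a * a"
proof -
  define y where "y = y_step T T' x"
  have y_err: "norm (y - xs) \<le> eta1 \<psi>0 \<psi> a * a"
    unfolding y_def a_def using x by (intro y_step_error) (auto simp: a_def)
  have yp: "\<psi>0 * norm (y - xs) \<le> p_fun \<psi>0 \<psi> a"
    using mult_left_mono[OF y_err, of \<psi>0] psi by (simp add: p_fun_def mult_ac)
  note x = x[unfolded a_def]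
  have yD: "y \<in> D" using y by (simp add: y_def)
  have "z1_step T T' x - xs = (x - xs - B x (T x)) + (B x (T x) - B y (T x))"
    by (simp add: z1_step_def y_def)
  then have "norm (z1_step T T' x - xs) \<le> norm (x - xs - B x (T x)) + norm (B x (T x) - B y (T x))"
    by (simp only: norm_triangle_ineq)
  also have "norm (x - xs - B x (T x)) \<le> \<psi> * a * a / (2 * (1 - \<psi>0 * a))"
    using newton_error[OF x] by (simp add: a_def)
  also have "norm (B x (T x) - B y (T x))
      \<le> \<psi> * (a + eta1 \<psi>0 \<psi> a * a) / (1 - \<psi>0 * a) * (1 / (1 - p_fun \<psi>0 \<psi> a)) * norm (G (T x))"
    unfolding a_def by (rule norm_B_diff) (use x yD yp p y_err in \<open>auto simp: a_def\<close>)
  also have "\<dots> \<le> \<psi> * (a + eta1 \<psi>0 \<psi> a * a) / (1 - \<psi>0 * a) * (1 / (1 - p_fun \<psi>0 \<psi> a))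
      * ((1 + \<psi>0 / 2 * a) * a)"
  proof (rule mult_left_mono)
    show "norm (G (T x)) \<le> (1 + \<psi>0 / 2 * a) * a"
      unfolding a_def by (rule norm_G_T[OF x(1)])
    have "0 \<le> eta1 \<psi>0 \<psi> a * a"
      using y_err norm_ge_zero order_trans by blast
    then show "0 \<le> \<psi> * (a + eta1 \<psi>0 \<psi> a * a) / (1 - \<psi>0 * a) * (1 / (1 - p_fun \<psi>0 \<psi> a))"
      using x psi p by (auto simp: a_def)
  qed
  also have "\<psi> * a * a / (2 * (1 - \<psi>0 * a)) + \<dots> = eta2 \<psi>0 \<psi> a * a"
  proof -
    define A P where "A = 1 - \<psi>0 * a" and "P = 1 - p_fun \<psi>0 \<psi> a"
    show ?thesis
      unfolding eta2_def A_def[symmetric] P_def[symmetric]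
      by (cases "A = 0"; cases "P = 0") (auto simp: field_simps)
  qed
  finally show ?thesis by simp
qed

text \<open>Covers both last substeps, with \<open>\<eta>\<close> equal to \<open>eta2\<close> or
  \<open>eta3\<close>. Writing \<open>B x - 2 B y\<close> as
  \<open>- B u + (B u - B y) + (B x - B y)\<close> splits the error into a Newton error and two
  differences of inverses, one for each summand of \<open>eta_next\<close>.\<close>

lemma correction_error:
  fixes x y u defines "a \<equiv> norm (x - xs)"
  assumes x: "x \<in> D" "\<psi>0 * a < 1"
    and y: "y \<in> D" "norm (y - xs) \<le> eta1 \<psi>0 \<psi> a * a" and p: "p_fun \<psi>0 \<psi> a < 1"
    and u: "u \<in> D" "norm (u - xs) \<le> \<eta> a * a" "\<psi>0 * \<eta> a * a < 1"
  shows "norm (u - (2 *\<^sub>R B y - B x) (T u) - xs) \<le> eta_next \<psi>0 \<psi> \<eta> a * a"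
proof -
  define b where "b = norm (u - xs)"
  define A P Q where "A = 1 - \<psi>0 * a" and "P = 1 - p_fun \<psi>0 \<psi> a" and "Q = 1 - \<psi>0 * \<eta> a * a"
  have pos: "0 < A" "0 < P" "0 < Q"
    using x p u by (auto simp: A_def P_def Q_def)
  have yp: "\<psi>0 * norm (y - xs) \<le> p_fun \<psi>0 \<psi> a"
    using mult_left_mono[OF y(2), of \<psi>0] psi by (simp add: p_fun_def mult_ac)
  have ya: "\<psi>0 * norm (y - xs) < 1"
    using yp p by simp
  have b: "0 \<le> b" "b \<le> \<eta> a * a" "Q \<le> 1 - \<psi>0 * b"
    using u(2) mult_left_mono[OF u(2), of \<psi>0] psi by (auto simp: b_def Q_def mult_ac)
  have ub: "\<psi>0 * norm (u - xs) < 1"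
    using b(3) pos by (simp add: b_def)
  \<comment> \<open>No sign of \<open>\<eta>\<close> is assumed, and \<open>a = 0\<close> is
    allowed; the products are nonnegative because they bound norms.\<close>
  have nonneg: "0 \<le> eta1 \<psi>0 \<psi> a * a" "0 \<le> \<eta> a * a" "0 \<le> a"
    using y(2) u(2) norm_ge_zero order_trans by (blast, blast, simp add: a_def)
  define g where "g = (1 + \<psi>0 / 2 * \<eta> a * a) * (\<eta> a * a)"
  have g: "norm (G (T u)) \<le> g"
    unfolding g_def mult.assoc using b nonneg psi
    by (intro order_trans[OF norm_G_T[OF u(1)]] mult_mono add_left_mono mult_left_mono)
      (auto simp: b_def)
  have "u - (2 *\<^sub>R B y - B x) (T u) - xs
      = (u - xs - B u (T u)) + ((B u (T u) - B y (T u)) + (B x (T u) - B y (T u)))"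
    by (simp add: blinfun.diff_left blinfun.add_left scaleR_2)
  then have "norm (u - (2 *\<^sub>R B y - B x) (T u) - xs)
      \<le> norm (u - xs - B u (T u)) + (norm (B u (T u) - B y (T u)) + norm (B x (T u) - B y (T u)))"
    by (simp only:) (intro norm_triangle_le add_mono norm_triangle_ineq order_refl)
  also have "\<dots> \<le> \<psi> * (\<eta> a * a) * (\<eta> a * a) / (2 * Q)
      + (\<psi> * ((eta1 \<psi>0 \<psi> a + \<eta> a) * a) / Q * (1 / P) * g + \<psi> * (a + eta1 \<psi>0 \<psi> a * a) / A * (1 / P) * g)"
  proof (intro add_mono)
    have "norm (u - xs - B u (T u)) \<le> \<psi> * b * b / (2 * (1 - \<psi>0 * b))"
      using newton_error[OF u(1) ub] by (simp add: b_def)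
    also have "\<dots> \<le> \<psi> * (\<eta> a * a) * (\<eta> a * a) / (2 * Q)"
    proof -
      have "\<psi> * b * b / (2 * (1 - \<psi>0 * b)) \<le> \<psi> * c * c / (2 * Q)" if "b \<le> c" for c
        using that b(1,3) pos psi by (intro frac_le mult_mono mult_nonneg_nonneg) auto
      then show ?thesis using b(2) by blast
    qed
    finally show "norm (u - xs - B u (T u)) \<le> \<psi> * (\<eta> a * a) * (\<eta> a * a) / (2 * Q)" .
    have "norm (B u (T u) - B y (T u))
        \<le> \<psi> * ((eta1 \<psi>0 \<psi> a + \<eta> a) * a) / (1 - \<psi>0 * b) * (1 / P) * norm (G (T u))"
      unfolding P_def b_def
      by (rule norm_B_diff) (use u(1,2) ub y ya yp p in \<open>auto simp: algebra_simps\<close>)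
    also have "\<dots> \<le> \<psi> * ((eta1 \<psi>0 \<psi> a + \<eta> a) * a) / Q * (1 / P) * g"
    proof -
      have "0 \<le> (eta1 \<psi>0 \<psi> a + \<eta> a) * a"
        unfolding distrib_right using nonneg(1,2) by (rule add_nonneg_nonneg)
      then have "0 \<le> \<psi> * ((eta1 \<psi>0 \<psi> a + \<eta> a) * a)"
        by (rule mult_nonneg_nonneg[OF less_imp_le[OF psi(2)]])
      \<comment> \<open>With the numerator abstracted to \<open>c\<close>, only its sign matters
        when \<open>1 - \<psi>0 * b\<close> is replaced by the smaller \<open>Q\<close>.\<close>
      moreover have "0 \<le> c / Q * (1 / P) \<and> c / (1 - \<psi>0 * b) * (1 / P) \<le> c / Q * (1 / P)"
        if "0 \<le> c" for c
        using that b(3) pos by (auto intro!: mult_right_mono divide_right_mono divide_left_mono)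
      ultimately have "0 \<le> \<psi> * ((eta1 \<psi>0 \<psi> a + \<eta> a) * a) / Q * (1 / P)"
          "\<psi> * ((eta1 \<psi>0 \<psi> a + \<eta> a) * a) / (1 - \<psi>0 * b) * (1 / P)
            \<le> \<psi> * ((eta1 \<psi>0 \<psi> a + \<eta> a) * a) / Q * (1 / P)"
        by blast+
      then show ?thesis
        by (rule mult_mono[rotated 2, OF _ norm_ge_zero _ g])
    qed
    finally show "norm (B u (T u) - B y (T u)) \<le> \<psi> * ((eta1 \<psi>0 \<psi> a + \<eta> a) * a) / Q * (1 / P) * g" .
    have "norm (B x (T u) - B y (T u)) \<le> \<psi> * (a + eta1 \<psi>0 \<psi> a * a) / A * (1 / P) * norm (G (T u))"
      unfolding P_def A_def a_def
      by (rule norm_B_diff) (use x y ya yp p in \<open>auto simp: a_def\<close>)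
    also have "\<dots> \<le> \<psi> * (a + eta1 \<psi>0 \<psi> a * a) / A * (1 / P) * g"
      using pos psi nonneg g by (intro mult_left_mono) auto
    finally show "norm (B x (T u) - B y (T u)) \<le> \<psi> * (a + eta1 \<psi>0 \<psi> a * a) / A * (1 / P) * g" .
  qed
  also have "\<dots> = eta_next \<psi>0 \<psi> \<eta> a * a"
    \<comment> \<open>The factor \<open>a\<close> is distributed so that the summands can be matched
      one by one, with the denominators kept opaque.\<close>
    unfolding eta_next_def g_def A_def[symmetric] P_def[symmetric] Q_def[symmetric]
    unfolding distrib_right[where c = a] distrib_right[where c = "\<eta> a"] add.assoc
    by (intro arg_cong2[where f = "(+)"]; simp) (simp add: algebra_simps)
  finally show ?thesis .
qed

text \<open>Since \<open>eta1\<close>, \<open>eta2\<close> and \<open>eta3\<close> are below 1 at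
  \<open>a\<close>, each intermediate point is no farther from \<open>xs\<close> than
  \<open>x\<close>. It therefore lies in \<open>D\<close>, and the next error bound becomes
  applicable.\<close>

lemma iteration_step:
  fixes x defines "a \<equiv> norm (x - xs)"
  assumes ball: "ball xs (radius \<psi>0 \<psi>) \<subseteq> D" and a: "a < radius \<psi>0 \<psi>"
  shows "step_well_defined T T' D x"
    "norm (y_step T T' x - xs) \<le> eta1 \<psi>0 \<psi> a * a"
    "norm (z1_step T T' x - xs) \<le> eta2 \<psi>0 \<psi> a * a"
    "norm (z2_step T T' x - xs) \<le> eta3 \<psi>0 \<psi> a * a"
    "norm (x_step T T' x - xs) \<le> eta4 \<psi>0 \<psi> a * a"
proof -
  have a0: "0 \<le> a" by (simp add: a_def)
  have eta: "eta1 \<psi>0 \<psi> a < 1" "eta2 \<psi>0 \<psi> a < 1" "eta3 \<psi>0 \<psi> a < 1"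
    using radius_properties(4)[OF psi a0 a] by auto
  have inD: "u \<in> D" if "norm (u - xs) \<le> e * a" "e < 1" for u e
  proof -
    have "norm (u - xs) < radius \<psi>0 \<psi>"
      using that mult_right_mono[of e 1 a] a0 a by simp
    then show ?thesis
      using ball by (auto simp: dist_norm norm_minus_commute)
  qed
  have less: "\<psi>0 * a < 1"
    using psi a radius_properties(2)[OF psi] by (simp add: field_simps)
      (meson less_trans mult_strict_left_mono)
  have less': "\<psi>0 * e * a < 1" if "e < 1" for e
  proof -
    have "e * (\<psi>0 * a) \<le> 1 * (\<psi>0 * a)"
      by (rule mult_right_mono) (use that psi a0 in auto)
    with less have "e * (\<psi>0 * a) < 1" by simp
    then show ?thesis by (simp only: mult_ac)
  qed
  have p: "p_fun \<psi>0 \<psi> a < 1"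
    unfolding p_fun_def by (rule less'[OF eta(1)])
  have x: "x \<in> D"
    using ball a by (auto simp: a_def dist_norm norm_minus_commute)
  show y: "norm (y_step T T' x - xs) \<le> eta1 \<psi>0 \<psi> a * a"
    unfolding a_def by (rule y_step_error) (use x less in \<open>auto simp: a_def\<close>)
  have yD: "y_step T T' x \<in> D" by (rule inD[OF y eta(1)])
  show z1: "norm (z1_step T T' x - xs) \<le> eta2 \<psi>0 \<psi> a * a"
    unfolding a_def by (rule z1_step_error) (use x yD less p in \<open>auto simp: a_def\<close>)
  have z1D: "z1_step T T' x \<in> D" by (rule inD[OF z1 eta(2)])
  show z2: "norm (z2_step T T' x - xs) \<le> eta3 \<psi>0 \<psi> a * a"
    unfolding z2_step_def eta3_def a_def
    by (rule correction_error) (use x yD y z1 z1D less less'[OF eta(2)] p in \<open>auto simp: a_def\<close>)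
  have z2D: "z2_step T T' x \<in> D" by (rule inD[OF z2 eta(3)])
  show "norm (x_step T T' x - xs) \<le> eta4 \<psi>0 \<psi> a * a"
    unfolding x_step_def eta4_def a_def
    by (rule correction_error) (use x yD y z2 z2D less less'[OF eta(3)] p in \<open>auto simp: a_def\<close>)
  have "\<psi>0 * norm (y_step T T' x - xs) < 1"
    using mult_left_mono[OF y, of \<psi>0] less'[OF eta(1)] psi(1) unfolding mult.assoc by linarith
  then show "step_well_defined T T' D x"
    unfolding step_well_defined_def
    using x yD z1D z2D less invertible by (auto simp: a_def)
qed

text \<open>With \<open>T w = 0\<close>, \<open>G_T_deviation\<close> bounds the distance of
  \<open>w\<close> to \<open>xs\<close> by \<open>\<psi>0 / 2\<close> times its square, which is
  impossible for a small positive distance.\<close>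

lemma unique_zero:
  assumes w: "w \<in> D" "T w = 0" "norm (w - xs) < 1 / \<psi>0"
  shows "w = xs"
proof (rule ccontr)
  assume "w \<noteq> xs"
  then have "0 < norm (w - xs)" by simp
  moreover have "\<psi>0 / 2 * norm (w - xs) < 1"
    using w(3) psi by (simp add: field_simps)
  ultimately have "\<psi>0 / 2 * norm (w - xs) * norm (w - xs) < norm (w - xs)"
    by (metis mult_less_cancel_right_disj mult_1)
  then show False
    using G_T_deviation[OF w(1)] w(2) by (simp add: blinfun.zero_right norm_minus_commute[of xs w])
qed

end

section \<open>Convergence of the whole iteration\<close>

text \<open>The maximum of \<open>\<eta>\<close> over the compact interval \<open>{0..d 0}\<close>
  is attained, hence less than 1, and serves as a uniform contraction factor.\<close>

lemma contracting_tendsto_zero: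
  fixes d :: "nat \<Rightarrow> real" and \<eta> :: "real \<Rightarrow> real"
  assumes d: "\<And>n. 0 \<le> d n" "\<And>n. d (Suc n) \<le> \<eta> (d n) * d n" "d 0 < r"
    and cont: "continuous_on {0..<r} \<eta>" and \<eta>: "\<And>a. 0 \<le> a \<Longrightarrow> a < r \<Longrightarrow> 0 \<le> \<eta> a \<and> \<eta> a < 1"
  shows "d \<longlonglongrightarrow> 0"
proof -
  have "\<exists>c\<in>{0..d 0}. \<forall>a\<in>{0..d 0}. \<eta> a \<le> \<eta> c"
    by (rule continuous_attains_sup)
      (use d in \<open>auto intro!: continuous_on_subset[OF cont]\<close>)
  then obtain c where c: "0 \<le> c" "c \<le> d 0" "\<And>a. 0 \<le> a \<Longrightarrow> a \<le> d 0 \<Longrightarrow> \<eta> a \<le> \<eta> c"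
    by auto
  have \<eta>c: "0 \<le> \<eta> c" "\<eta> c < 1"
    using \<eta>[of c] c d(3) by auto
  have bound: "d n \<le> \<eta> c ^ n * d 0" for n
  proof (induction n)
    case (Suc n)
    \<comment> \<open>The geometric bound itself keeps \<open>d n\<close> in the interval on which
      \<open>\<eta> c\<close> is the maximum.\<close>
    have "\<eta> c ^ n * d 0 \<le> d 0"
      using \<eta>c d(1) by (simp add: mult_left_le_one_le power_le_one)
    then have "\<eta> (d n) \<le> \<eta> c"
      using Suc d(1) c(3) by simp
    then have "d (Suc n) \<le> \<eta> c * (\<eta> c ^ n * d 0)"
      using Suc d(1) \<eta>c by (intro order_trans[OF d(2)] mult_mono) auto
    then show ?case by simp
  qed simp
  have "(\<lambda>n. \<eta> c ^ n * d 0) \<longlonglongrightarrow> 0"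
    using \<eta>c by (intro tendsto_mult_left_zero LIMSEQ_power_zero) simp
  then show ?thesis
    by (rule tendsto_sandwich[rotated -1, OF _ ]) (use d bound in auto)
qed

theorem theorem2p1:
  fixes D :: "'x::banach set"
    and T :: "'x \<Rightarrow> 'y::banach"
    and T' :: "'x \<Rightarrow> 'x \<Rightarrow>\<^sub>L 'y"
    and \<psi>0 \<psi> \<rho> :: real
    and xs x0 :: 'x
    and x y z1 z2 :: "nat \<Rightarrow> 'x"
  assumes D: "convex D" "open D"
    and deriv: "\<And>u. u \<in> D \<Longrightarrow> (T has_derivative blinfun_apply (T' u)) (at u)"
    and deriv_cont: "continuous_on D T'"
    and psi: "0 < \<psi>0" "0 < \<psi>" "\<psi>0 \<le> \<psi>"
    and xs: "xs \<in> D" "T xs = 0" "blinfun_invertible (T' xs)"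
    and center_lipschitz: "\<And>u. u \<in> D \<Longrightarrow>
      norm (blinfun_inv (T' xs) o\<^sub>L (T' u - T' xs)) \<le> \<psi>0 * norm (u - xs)"
    and lipschitz: "\<And>u v. u \<in> D \<Longrightarrow> v \<in> D \<Longrightarrow>
      norm (blinfun_inv (T' xs) o\<^sub>L (T' u - T' v)) \<le> \<psi> * norm (u - v)"
    and rho: "\<rho> = radius \<psi>0 \<psi>"
    and ball_subset: "ball xs \<rho> \<subseteq> D"
    and x0: "x0 \<in> ball xs \<rho> - {xs}"
    and sequences:
      "x = iterate T T' x0"
      "y = (\<lambda>n. y_step T T' (x n))"
      "z1 = (\<lambda>n. z1_step T T' (x n))"
      "z2 = (\<lambda>n. z2_step T T' (x n))"
  shows "(\<forall>n. step_well_defined T T' D (x n) \<and> x n \<in> ball xs \<rho>)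
    \<and> x \<longlonglongrightarrow> xs
    \<and> (\<forall>n. norm (y n - xs) \<le> eta1 \<psi>0 \<psi> (norm (x n - xs)) * norm (x n - xs)
         \<and> eta1 \<psi>0 \<psi> (norm (x n - xs)) * norm (x n - xs) \<le> norm (x n - xs)
         \<and> norm (x n - xs) < \<rho>)
    \<and> (\<forall>n. norm (z1 n - xs) \<le> eta2 \<psi>0 \<psi> (norm (x n - xs)) * norm (x n - xs)
         \<and> eta2 \<psi>0 \<psi> (norm (x n - xs)) * norm (x n - xs) \<le> norm (x n - xs)
         \<and> norm (x n - xs) < \<rho>)
    \<and> (\<forall>n. norm (z2 n - xs) \<le> eta3 \<psi>0 \<psi> (norm (x n - xs)) * norm (x n - xs)
         \<and> eta3 \<psi>0 \<psi> (norm (x n - xs)) * norm (x n - xs) \<le> norm (x n - xs)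
         \<and> norm (x n - xs) < \<rho>)
    \<and> (\<forall>n. norm (x (Suc n) - xs) \<le> eta4 \<psi>0 \<psi> (norm (x n - xs)) * norm (x n - xs)
         \<and> eta4 \<psi>0 \<psi> (norm (x n - xs)) * norm (x n - xs) \<le> norm (x n - xs)
         \<and> norm (x n - xs) < \<rho>)
    \<and> (\<forall>\<sigma>. \<rho> \<le> \<sigma> \<and> \<sigma> < 1 / \<psi>0 \<and> cball xs \<sigma> \<subseteq> D
         \<longrightarrow> {w \<in> D \<inter> cball xs \<sigma>. T w = 0} = {xs})"
proof -
  interpret local_convergence D T T' \<psi>0 \<psi> xs
    using D deriv psi xs center_lipschitz lipschitz by unfold_locales auto
  note radius = radius_properties[OF psi(1,2), folded rho]
  note step = iteration_step[folded rho, OF ball_subset]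
  have x_Suc: "x (Suc n) = x_step T T' (x n)" for n
    by (simp add: sequences iterate_def)
  have below: "e * a \<le> a" if "e < 1" "0 \<le> a" for e a :: real
    using that mult_right_mono[of e 1 a] by simp
  have x_less: "norm (x n - xs) < \<rho>" for n
  proof (induction n)
    case 0
    then show ?case
      using x0 by (simp add: sequences iterate_def dist_norm norm_minus_commute)
  next
    case (Suc n)
    then show ?case
      using step(5)[OF Suc] below radius(4)[OF norm_ge_zero Suc] unfolding x_Suc
      by (meson atLeastLessThan_iff norm_ge_zero order_le_less_trans order_trans)
  qed
  \<comment> \<open>The contraction factor here is \<open>eta4\<close>, continuous on
    \<open>{0..<\<rho>}\<close> by \<open>radius(3)\<close>.\<close>
  have "(\<lambda>n. norm (x n - xs)) \<longlonglongrightarrow> 0"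
    by (rule contracting_tendsto_zero[OF _ _ x_less radius(3)])
      (use step(5)[OF x_less] radius(4) in \<open>auto simp: x_Suc\<close>)
  then have "x \<longlonglongrightarrow> xs"
    by (simp add: tendsto_norm_zero_iff LIM_zero_iff)
  \<comment> \<open>\<open>0 < \<rho> \<le> \<sigma>\<close> puts \<open>xs\<close> in the closed
    ball, and \<open>\<sigma> < 1 / \<psi>0\<close> excludes any other zero there.\<close>
  moreover have "{w \<in> D \<inter> cball xs \<sigma>. T w = 0} = {xs}" if "\<rho> \<le> \<sigma>" "\<sigma> < 1 / \<psi>0" for \<sigma>
    using that xs radius(1) unique_zero by (auto simp: dist_norm norm_minus_commute)
  moreover have "x n \<in> ball xs \<rho>" for n
    using x_less[of n] by (simp add: dist_norm norm_minus_commute)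
  moreover have "eta1 \<psi>0 \<psi> (norm (x n - xs)) * norm (x n - xs) \<le> norm (x n - xs)"
      "eta2 \<psi>0 \<psi> (norm (x n - xs)) * norm (x n - xs) \<le> norm (x n - xs)"
      "eta3 \<psi>0 \<psi> (norm (x n - xs)) * norm (x n - xs) \<le> norm (x n - xs)"
      "eta4 \<psi>0 \<psi> (norm (x n - xs)) * norm (x n - xs) \<le> norm (x n - xs)" for n
    using radius(4)[OF norm_ge_zero x_less[of n]] by (intro below; simp)+
  ultimately show ?thesis
    using step[OF x_less] x_less unfolding sequences(2-4) x_Suc by blast
qed

end
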